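(* Let $S$ be a subsemigroup of $((0,\infty),+)$ which is dense in $(0,\infty)$ and let $A$ be a subtracted image partition regular matrix near zero over $S$. Then $A$ is image partition regular near zero over $S$.
   Context: An $\omega\times\omega$ matrix $A$ with entries from $\mathbb Q$ is subtracted image partition regular near zero over $S$ if (1) no row of $A$ is $\vec 0$, (2) each row of $A$ has only finitely many nonzero entries, and (3) there exist $v\in\mathbb N$, an $\omega\times v$ matrix $A_1$ and an $\omega\times\omega$ matrix $A_2$ such that $A=(A_1\ A_2)$, every row of $A_1$ is a row of some fixed finite image partition regular matrix $D$, and $A_2$ is image partition regular near zero over $S$. A finite $u\times v$ rational matrix $D$ is image partition regular if it has no zero row and whenever $\mathbb N$ is finitely colored there is $\vec x\in\mathbb N^v$ with all entries of $D\vec x$ of the same color. An admissible (rational entries, no zero row, finitely many nonzero entries in each row) $\alpha\times\delta$ matrix $B$ is image partition regular near zero over $S$ if whenever $S$ is finitely colored and $\varepsilon>0$, there is $\vec x\in S^\delta$ such that the entries of $B\vec x$ are monochromatic and lie in $(-\varepsilon,\varepsilon)$. *)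

theory Defs
  imports "HOL-Analysis.Analysis" "HOL-Library.Extended_Nat"
begin

(* A rational "al x de" matrix with al, de in omega + {omega} is a function B :: nat => nat => rat
   together with al, de :: enat; only the entries B i j with enat i < al and enat j < de are
   meaningful, and the size \<infinity> stands for omega. A vector of length de is likewise a function
   on nat of which only the coordinates j with enat j < de are used. *)

definition admissible :: "enat \<Rightarrow> enat \<Rightarrow> (nat \<Rightarrow> nat \<Rightarrow> rat) \<Rightarrow> bool" where
  "admissible \<alpha> \<delta> B \<longleftrightarrow>
     (\<forall>i. enat i < \<alpha> \<longrightarrow> (\<exists>j. enat j < \<delta> \<and> B i j \<noteq> 0) \<and> finite {j. enat j < \<delta> \<and> B i j \<noteq> 0})"

(* The i-th entry of B x. For an admissible B the sum is finite. *)
definition mat_app :: "enat \<Rightarrow> (nat \<Rightarrow> nat \<Rightarrow> rat) \<Rightarrow> (nat \<Rightarrow> real) \<Rightarrow> nat \<Rightarrow> real" where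
  "mat_app \<delta> B x i = (\<Sum>j | enat j < \<delta> \<and> B i j \<noteq> 0. of_rat (B i j) * x j)"

definition finite_coloring :: "real set \<Rightarrow> (real \<Rightarrow> nat) \<Rightarrow> bool" where
  "finite_coloring S f \<longleftrightarrow> finite (f ` S)"

(* Only elements of S carry a color, so a monochromatic set is contained in S. *)
definition monochromatic :: "real set \<Rightarrow> (real \<Rightarrow> nat) \<Rightarrow> real set \<Rightarrow> bool" where
  "monochromatic S f Y \<longleftrightarrow> Y \<subseteq> S \<and> (\<exists>c. \<forall>y\<in>Y. f y = c)"

definition pos_nats :: "real set" where
  "pos_nats = real ` {1..}"

definition image_partition_regular :: "nat \<Rightarrow> nat \<Rightarrow> (nat \<Rightarrow> nat \<Rightarrow> rat) \<Rightarrow> bool" where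
  "image_partition_regular u v D \<longleftrightarrow>
     admissible (enat u) (enat v) D \<and>
     (\<forall>f. finite_coloring pos_nats f \<longrightarrow>
       (\<exists>x. (\<forall>j<v. x j \<in> pos_nats) \<and>
            monochromatic pos_nats f {mat_app (enat v) D x i | i. i < u}))"

definition image_partition_regular_near_zero ::
    "real set \<Rightarrow> enat \<Rightarrow> enat \<Rightarrow> (nat \<Rightarrow> nat \<Rightarrow> rat) \<Rightarrow> bool" where
  "image_partition_regular_near_zero S \<alpha> \<delta> B \<longleftrightarrow>
     admissible \<alpha> \<delta> B \<and>
     (\<forall>f \<epsilon>. finite_coloring S f \<and> 0 < \<epsilon> \<longrightarrow>
       (\<exists>x. (\<forall>j. enat j < \<delta> \<longrightarrow> x j \<in> S) \<and>
            monochromatic S f {mat_app \<delta> B x i | i. enat i < \<alpha>} \<and>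
            {mat_app \<delta> B x i | i. enat i < \<alpha>} \<subseteq> {-\<epsilon><..<\<epsilon>}))"

(* The block matrix (A1 A2), where A1 has v columns. *)
definition append_columns ::
    "nat \<Rightarrow> (nat \<Rightarrow> nat \<Rightarrow> rat) \<Rightarrow> (nat \<Rightarrow> nat \<Rightarrow> rat) \<Rightarrow> nat \<Rightarrow> nat \<Rightarrow> rat" where
  "append_columns v A1 A2 i j = (if j < v then A1 i j else A2 i (j - v))"

definition subtracted_image_partition_regular_near_zero ::
    "real set \<Rightarrow> (nat \<Rightarrow> nat \<Rightarrow> rat) \<Rightarrow> bool" where
  "subtracted_image_partition_regular_near_zero S A \<longleftrightarrow>
     (\<forall>i. \<exists>j. A i j \<noteq> 0) \<and>
     (\<forall>i. finite {j. A i j \<noteq> 0}) \<and>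
     (\<exists>v A1 A2. 0 < v \<and> A = append_columns v A1 A2 \<and>
        (\<exists>u D. image_partition_regular u v D \<and> (\<forall>i. \<exists>k<u. \<forall>j<v. A1 i j = D k j)) \<and>
        image_partition_regular_near_zero S \<infinity> \<infinity> A2)"

end

theory Submission
  imports Defs "HOL-Library.Diagonal_Subsequence"
begin

text \<open>For a colouring \<open>f\<close> of \<open>S\<close> and the finite matrix \<open>D\<close>, compactness gives a bound \<open>M\<close> such that
  some \<open>D x\<close> is monochromatic inside \<open>{1..M}\<close> for every colouring with as many colours. Pick \<open>s \<in> S\<close>
  with \<open>M s\<close> small and colour \<open>t \<in> S\<close> by the tuple of the colours of \<open>k s + t\<close> for \<open>1 \<le> k \<le> M\<close>. If
  \<open>A\<^sub>2 y\<close> is monochromatic for this product colouring, then the colour of \<open>k s + (A\<^sub>2 y)\<^sub>i\<close> depends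
  only on \<open>k\<close>. Choosing \<open>x\<close> with \<open>D x\<close> monochromatic for this colouring of \<open>{1..M}\<close> makes
  \<open>A (s x, y)\<close> monochromatic.\<close>

text \<open>This is sequential compactness of the product of countably many copies of the discrete
  space \<open>{0..K}\<close>, where convergence of a coordinate means that it is eventually
  constant. By pigeonhole any subsequence can be refined so that coordinate \<open>k\<close> becomes
  constant, and diagonalisation handles all \<open>k\<close> together.\<close>

lemma bounded_nat_functions_convergent_subsequence:
  fixes h :: "nat \<Rightarrow> nat \<Rightarrow> nat"
  assumes "\<And>n k. h n k \<le> K"
  obtains \<phi> :: "nat \<Rightarrow> nat" and H where "strict_mono \<phi>"
    and "\<And>k. H k \<le> K" and "\<And>k. \<forall>\<^sub>F n in sequentially. h (\<phi> n) k = H k"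
proof -
  interpret subseqs "\<lambda>k r. \<exists>c. \<forall>\<^sub>F n in sequentially. h (r n) k = c"
  proof
    fix k and r :: "nat \<Rightarrow> nat"
    assume "strict_mono r"
    have "finite (range (\<lambda>n. h (r n) k))"
      by (rule finite_subset[of _ "{..K}"]) (use assms in auto)
    then obtain c where "infinite {n. h (r n) k = c}"
      using pigeonhole_infinite[of UNIV "\<lambda>n. h (r n) k"] by auto
    from infinite_enumerate[OF this] obtain r' :: "nat \<Rightarrow> nat"
      where r': "strict_mono r'" "\<And>n. h (r (r' n)) k = c"
      unfolding mem_Collect_eq by blast
    then have "\<forall>\<^sub>F n in sequentially. h ((r \<circ> r') n) k = c" by simp
    with r'(1) show "\<exists>r'. strict_mono r' \<and> (\<exists>c. \<forall>\<^sub>F n in sequentially. h ((r \<circ> r') n) k = c)"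
      by blast
  qed
  \<comment> \<open>Only the tail of the diagonal sequence from index \<open>Suc k\<close> on is a
    subsequence of the refinement that settles coordinate \<open>k\<close>. The shift is removed
    afterwards because eventual statements ignore finitely many indices.\<close>
  have "\<exists>c. \<forall>\<^sub>F n in sequentially. h ((diagseq \<circ> (+) (Suc k)) n) k = c" for k
  proof (rule diagseq_holds)
    fix s r :: "nat \<Rightarrow> nat" and k
    assume s: "strict_mono s" and "\<exists>c. \<forall>\<^sub>F n in sequentially. h (r n) k = c"
    then obtain c where "\<forall>\<^sub>F n in sequentially. h (r n) k = c" by blast
    then have "\<forall>\<^sub>F n in sequentially. h (r (s n)) k = c"
      by (rule eventually_subseq[OF s])
    then show "\<exists>c. \<forall>\<^sub>F n in sequentially. h ((r \<circ> s) n) k = c" by auto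
  qed
  then have "\<exists>c. \<forall>\<^sub>F n in sequentially. h (diagseq (n + Suc k)) k = c" for k
    unfolding o_def by (subst add.commute)
  then have "\<forall>k. \<exists>c. \<forall>\<^sub>F n in sequentially. h (diagseq n) k = c"
    unfolding eventually_sequentially_seg[of "\<lambda>n. h (diagseq n) _ = _"] by blast
  from choice[OF this] obtain H where H: "\<And>k. \<forall>\<^sub>F n in sequentially. h (diagseq n) k = H k"
    by blast
  have "H k \<le> K" for k
  proof -
    obtain n where "h (diagseq n) k = H k"
      using eventually_happens'[OF sequentially_bot H[of k]] by blast
    then show ?thesis using assms[of "diagseq n" k] by simp
  qed
  then show ?thesis using that[OF subseq_diagseq] H by blast
qed

text \<open>If each \<open>M\<close> had a bad colouring \<open>h M\<close>, a subsequence of them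
  would converge pointwise to a colouring \<open>H\<close>. A solution \<open>x\<close> for
  \<open>H\<close> involves only finitely many numbers, so some late \<open>h (\<phi> n)\<close>
  agrees with \<open>H\<close> on all of them while \<open>\<phi> n\<close> exceeds them, and
  \<open>x\<close> refutes its badness.\<close>

lemma image_partition_regular_bounded:
  assumes "image_partition_regular u v D"
  obtains M where "\<And>h :: nat \<Rightarrow> nat. (\<And>k. h k \<le> K) \<Longrightarrow>
    \<exists>x c. (\<forall>j<v. x j \<in> pos_nats) \<and>
      (\<forall>i<u. \<exists>k\<in>{1..M}. mat_app (enat v) D x i = real k \<and> h k = c)"
proof (rule ccontr)
  let ?good = "\<lambda>M h x c. (\<forall>j<v. x j \<in> pos_nats) \<and>
      (\<forall>i<u. \<exists>k\<in>{1..M}. mat_app (enat v) D x i = real k \<and> h k = c)"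
  assume "\<not> thesis"
  with that have "\<forall>M. \<exists>h :: nat \<Rightarrow> nat. (\<forall>k. h k \<le> K) \<and> \<not> (\<exists>x c. ?good M h x c)"
    by blast
  then obtain h :: "nat \<Rightarrow> nat \<Rightarrow> nat"
    where hK: "\<And>M k. h M k \<le> K" and bad: "\<And>M x c. \<not> ?good M (h M) x c"
    by metis
  obtain \<phi> H where \<phi>: "strict_mono \<phi>" and HK: "\<And>k. H k \<le> K"
    and ev: "\<And>k. \<forall>\<^sub>F n in sequentially. h (\<phi> n) k = H k"
    using bounded_nat_functions_convergent_subsequence[of h K, OF hK] by metis
  \<comment> \<open>Colourings are defined on reals; \<open>nat \<lfloor>y\<rfloor>\<close> inverts
    \<open>real\<close> on \<open>pos_nats\<close>, so it carries \<open>H\<close> over.\<close>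
  have "finite_coloring pos_nats (\<lambda>y. H (nat \<lfloor>y\<rfloor>))"
    unfolding finite_coloring_def by (rule finite_subset[of _ "{..K}"]) (use HK in auto)
  then obtain x where x: "\<forall>j<v. x j \<in> pos_nats"
    and mono: "monochromatic pos_nats (\<lambda>y. H (nat \<lfloor>y\<rfloor>)) {mat_app (enat v) D x i | i. i < u}"
    using assms unfolding image_partition_regular_def by blast
  from mono obtain c where c: "\<And>i. i < u \<Longrightarrow> H (nat \<lfloor>mat_app (enat v) D x i\<rfloor>) = c"
    unfolding monochromatic_def by blast
  have "\<forall>i<u. \<exists>k\<ge>1. mat_app (enat v) D x i = real k"
    using mono unfolding monochromatic_def pos_nats_def by fastforce
  then obtain m where m: "\<And>i. i < u \<Longrightarrow> 1 \<le> m i \<and> mat_app (enat v) D x i = real (m i)"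
    by metis
  have "\<forall>\<^sub>F n in sequentially. h (\<phi> n) (m i) = H (m i) \<and> m i \<le> \<phi> n" for i
    using ev[of "m i"] eventually_ge_at_top[of "m i"]
    by eventually_elim (use seq_suble[OF \<phi>] le_trans in blast)
  \<comment> \<open>One \<open>n\<close> serves all rows at once because \<open>D\<close> has only
    finitely many of them.\<close>
  then have "\<forall>\<^sub>F n in sequentially. \<forall>i\<in>{..<u}. h (\<phi> n) (m i) = H (m i) \<and> m i \<le> \<phi> n"
    by (intro eventually_ball_finite) auto
  then obtain n where n: "\<And>i. i < u \<Longrightarrow> h (\<phi> n) (m i) = H (m i) \<and> m i \<le> \<phi> n"
    using eventually_happens'[OF sequentially_bot] by fastforce
  have "?good (\<phi> n) (h (\<phi> n)) x c"
  proof (intro conjI allI impI)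
    fix i assume i: "i < u"
    show "\<exists>k\<in>{1..\<phi> n}. mat_app (enat v) D x i = real k \<and> h (\<phi> n) k = c"
      using m[OF i] n[OF i] c[OF i] by (intro bexI[of _ "m i"]) auto
  qed (use x in blast)
  with bad show False by blast
qed

text \<open>The finiteness assumption matters because a sum over an infinite set is 0 by convention:
  an infinite support in \<open>A2\<close> would also erase the contribution of
  \<open>A1\<close>.\<close>

lemma mat_app_append_columns:
  assumes "finite {j. append_columns v A1 A2 i j \<noteq> 0}"
  shows "mat_app \<infinity> (append_columns v A1 A2) (\<lambda>j. if j < v then x j else y (j - v)) i
    = mat_app (enat v) A1 x i + mat_app \<infinity> A2 y i"
proof -
  let ?A = "append_columns v A1 A2"
  let ?g = "\<lambda>j. of_rat (?A i j) * (if j < v then x j else y (j - v))"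
  let ?L = "{j. j < v \<and> A1 i j \<noteq> 0}" and ?R = "{j. A2 i j \<noteq> 0}"
  have split: "{j. ?A i j \<noteq> 0} = ?L \<union> (\<lambda>j. j + v) ` ?R" (is "_ = ?L \<union> ?R'")
  proof (rule set_eqI)
    fix j
    show "j \<in> {j. ?A i j \<noteq> 0} \<longleftrightarrow> j \<in> ?L \<union> ?R'"
      by (cases "j < v") (auto simp: append_columns_def image_iff intro!: exI[of _ "j - v"])
  qed
  have "finite ?R'" using assms unfolding split by simp
  then have "sum ?g {j. ?A i j \<noteq> 0} = sum ?g ?L + sum ?g ?R'"
    unfolding split by (subst sum.union_disjoint) auto
  also have "sum ?g ?L = mat_app (enat v) A1 x i"
    unfolding mat_app_def by (rule sum.cong) (auto simp: append_columns_def)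
  also have "sum ?g ?R' = mat_app \<infinity> A2 y i"
    unfolding mat_app_def by (subst sum.reindex) (auto simp: append_columns_def)
  finally show ?thesis by (simp add: mat_app_def)
qed

lemma mat_app_scale: "mat_app \<delta> B (\<lambda>j. s * x j) i = s * mat_app \<delta> B x i"
  by (simp add: mat_app_def sum_distrib_left algebra_simps)

lemma mat_app_cong_row:
  assumes "\<And>j. enat j < \<delta> \<Longrightarrow> B i j = C k j"
  shows "mat_app \<delta> B x i = mat_app \<delta> C x k"
  unfolding mat_app_def by (rule sum.cong) (use assms in auto)

lemma add_closed_nat_mult:
  fixes s :: real
  assumes add: "\<And>s t. s \<in> S \<Longrightarrow> t \<in> S \<Longrightarrow> s + t \<in> S" and "s \<in> S" "1 \<le> k"
  shows "real k * s \<in> S"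
  using \<open>1 \<le> k\<close>
proof (induction k rule: dec_induct)
  case base
  then show ?case using \<open>s \<in> S\<close> by simp
next
  case (step k)
  then show ?case using add[OF \<open>s \<in> S\<close>] by (simp add: distrib_right)
qed

lemma dense_small_element:
  fixes S :: "real set"
  assumes "S \<subseteq> {0<..}" "{0<..} \<subseteq> closure S" "0 < \<epsilon>"
  obtains s where "s \<in> S" "0 < s" "s < \<epsilon>"
proof -
  have "\<epsilon> / 2 \<in> closure S" using assms by auto
  then obtain s where "s \<in> S" "dist s (\<epsilon> / 2) < \<epsilon> / 2"
    using \<open>0 < \<epsilon>\<close> unfolding closure_approachable by (metis half_gt_zero)
  moreover from this have "0 < s" "s < \<epsilon>"
    using assms(1) unfolding dist_real_def by (auto, argo)
  ultimately show ?thesis using that by blast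
qed

theorem theorem3p3:
  fixes S :: "real set" and A :: "nat \<Rightarrow> nat \<Rightarrow> rat"
  assumes "S \<subseteq> {0<..}"
    and "\<And>s t. s \<in> S \<Longrightarrow> t \<in> S \<Longrightarrow> s + t \<in> S"
    and "{0<..} \<subseteq> closure S"
    and "subtracted_image_partition_regular_near_zero S A"
  shows "image_partition_regular_near_zero S \<infinity> \<infinity> A"
proof -
  obtain v A1 A2 u D where nz: "\<And>i. \<exists>j. A i j \<noteq> 0" and fin: "\<And>i. finite {j. A i j \<noteq> 0}"
    and A: "A = append_columns v A1 A2" and D: "image_partition_regular u v D"
    and rows: "\<And>i. \<exists>k<u. \<forall>j<v. A1 i j = D k j"
    and A2: "image_partition_regular_near_zero S \<infinity> \<infinity> A2"
    using assms(4) unfolding subtracted_image_partition_regular_near_zero_def by blast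
  have "\<exists>x. (\<forall>j. enat j < \<infinity> \<longrightarrow> x j \<in> S) \<and> monochromatic S f {mat_app \<infinity> A x i | i. enat i < \<infinity>} \<and>
            {mat_app \<infinity> A x i | i. enat i < \<infinity>} \<subseteq> {-\<epsilon><..<\<epsilon>}"
    if f: "finite_coloring S f" and \<epsilon>: "0 < \<epsilon>" for f and \<epsilon> :: real
  proof -
    have finS: "finite (f ` S)" using f unfolding finite_coloring_def .
    then obtain K where K: "\<And>t. t \<in> S \<Longrightarrow> f t \<le> K"
      by (meson finite_nat_set_iff_bounded_le imageI)
    \<comment> \<open>The bound has to be uniform in \<open>h\<close>: the colouring to which it is
      applied depends on \<open>s\<close> and \<open>y\<close>, and both are chosen after
      \<open>M\<close>.\<close>
    obtain M where M: "\<And>h :: nat \<Rightarrow> nat. (\<And>k. h k \<le> K) \<Longrightarrow>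
      \<exists>x c. (\<forall>j<v. x j \<in> pos_nats) \<and>
        (\<forall>i<u. \<exists>k\<in>{1..M}. mat_app (enat v) D x i = real k \<and> h k = c)"
      using image_partition_regular_bounded[OF D] by blast
    \<comment> \<open>This makes \<open>k * s\<close> smaller than \<open>\<epsilon> / 2\<close> for
      every \<open>k\<close> up to \<open>M\<close>, leaving the other half of
      \<open>\<epsilon>\<close> for \<open>A2 y\<close>. The \<open>+ 1\<close> keeps the
      denominator positive without a case distinction on \<open>M\<close>.\<close>
    obtain s where s: "s \<in> S" "0 < s" "s < \<epsilon> / (2 * (real M + 1))"
      using dense_small_element[OF assms(1,3), of "\<epsilon> / (2 * (real M + 1))"] \<epsilon> by auto
    have ks: "real k * s \<in> S" if "1 \<le> k" for k
      using add_closed_nat_mult[OF assms(2) s(1) that] .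
    define G where "G t = map (\<lambda>k. f (real k * s + t)) [1..<Suc M]" for t
    have "G ` S \<subseteq> {xs. set xs \<subseteq> f ` S \<and> length xs = M}"
      unfolding G_def using ks assms(2) by auto
    then have "finite (G ` S)"
      using finite_lists_length_eq[OF finS] finite_subset by blast
    then have "finite (to_nat ` G ` S)" by (rule finite_imageI)
    then have "finite_coloring S (to_nat \<circ> G)"
      unfolding finite_coloring_def by (simp add: image_comp)
    then have "finite_coloring S (to_nat \<circ> G) \<and> 0 < \<epsilon> / 2" using \<epsilon> by simp
    with A2 obtain y where yS: "\<And>j. y j \<in> S"
      and mono: "monochromatic S (to_nat \<circ> G) {mat_app \<infinity> A2 y i | i. enat i < \<infinity>}"
      and small: "{mat_app \<infinity> A2 y i | i. enat i < \<infinity>} \<subseteq> {-(\<epsilon> / 2)<..<\<epsilon> / 2}"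
      unfolding image_partition_regular_near_zero_def by (meson enat_ord_code(4))
    let ?b = "mat_app \<infinity> A2 y"
    have bS: "?b i \<in> S" for i
      using mono unfolding monochromatic_def by auto
    have b_small: "?b i \<in> {-(\<epsilon> / 2)<..<\<epsilon> / 2}" for i
      using small by (rule subsetD) auto
    obtain c0 where c0: "\<And>i. to_nat (G (?b i)) = c0"
      using mono unfolding monochromatic_def by auto
    have G_const: "G (?b i) = G (?b 0)" for i
      using c0[of i] c0[of 0] by (metis from_nat_to_nat)
    have f_const: "f (real k * s + ?b i) = f (real k * s + ?b 0)" if "k \<in> {1..M}" for i k
      using G_const[of i] that unfolding G_def map_eq_conv by (simp del: upt_Suc)
    \<comment> \<open>The minimum only matters when the argument of \<open>f\<close> lies outside \<open>S\<close>, which cannot happen for \<open>k \<ge> 1\<close>.\<close>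
    define h where "h k = min K (f (real k * s + ?b 0))" for k
    obtain x c where x: "\<And>j. j < v \<Longrightarrow> x j \<in> pos_nats"
      and xc: "\<And>i. i < u \<Longrightarrow> \<exists>k\<in>{1..M}. mat_app (enat v) D x i = real k \<and> h k = c"
      using M[of h] unfolding h_def by auto
    let ?z = "\<lambda>j. if j < v then s * x j else y (j - v)"
    have zS: "?z j \<in> S" for j
    proof (cases "j < v")
      case True
      then obtain k where "1 \<le> k" "x j = real k"
        using x unfolding pos_nats_def by fastforce
      then show ?thesis using ks[of k] True by (simp add: mult.commute)
    qed (use yS in simp)
    have entry: "mat_app \<infinity> A ?z i \<in> S \<and> f (mat_app \<infinity> A ?z i) = c
        \<and> mat_app \<infinity> A ?z i \<in> {-\<epsilon><..<\<epsilon>}" for i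
    proof -
      obtain r where r: "r < u" "\<forall>j<v. A1 i j = D r j" using rows by blast
      obtain k where k: "k \<in> {1..M}" "mat_app (enat v) D x r = real k" "h k = c"
        using xc[OF r(1)] by blast
      have "mat_app (enat v) A1 x i = real k"
        using mat_app_cong_row[of "enat v" A1 i D r x] r(2) k(2) by simp
      then have val: "mat_app \<infinity> A ?z i = real k * s + ?b i"
        using fin[of i] unfolding A
        by (subst mat_app_append_columns) (auto simp: mat_app_scale mult.commute)
      \<comment> \<open>Two instances are used: \<open>j = i\<close> places the entry itself in
        \<open>S\<close>, and \<open>j = 0\<close> lets \<open>K\<close> bound the reference colour,
        so that the \<open>min\<close> in \<open>h\<close> has no effect.\<close>
      have in_S: "real k * s + ?b j \<in> S" for j
        using assms(2)[OF ks bS] k(1) by simp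
      have "f (real k * s + ?b i) = c"
        using f_const[OF k(1)] k(3) K[OF in_S[of 0]] unfolding h_def by simp
      moreover have "0 \<le> real k * s" "real k * s < \<epsilon> / 2"
      proof -
        have "real k * s \<le> (real M + 1) * s" using k(1) s(2) by (intro mult_right_mono) auto
        also have "\<dots> < \<epsilon> / 2" using s(3) by (simp add: field_simps)
        finally show "real k * s < \<epsilon> / 2" .
      qed (use s(2) in simp)
      ultimately show ?thesis
        unfolding val using in_S b_small[of i] by auto
    qed
    show ?thesis
      by (intro exI[of _ ?z]) (use zS entry in \<open>auto simp: monochromatic_def\<close>)
  qed
  then show ?thesis
    unfolding image_partition_regular_near_zero_def admissible_def using nz fin by simp
qed

end
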